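(* Let $\mathcal{H}$ be a complex Hilbert space and let $T\in\mathcal{L}^h$ have closed range with positive orthogonal decomposition $T=T_1-T_2$. The polar proper splitting $T=U_T-V$ of $T$ converges if and only if the proper splittings $T=T_1-P_{T_2}-W$ and $T=P_{T_1}-T_2-Z$ both converge. Moreover, in such case, $\max\{\rho((T_1-P_{T_2})^\dagger W),\rho((P_{T_1}-T_2)^\dagger Z)\}=\rho(U_T^*V)$.
   Context: $\mathcal{L}(\mathcal{H})$ is the algebra of bounded linear operators on $\mathcal{H}$; $\mathcal{L}^h$ and $\mathcal{L}^+$ are the sets of selfadjoint and positive (semidefinite) operators in it; $\mathcal{R}(\cdot)$, $\mathcal{N}(\cdot)$ denote range and nullspace; $\rho(\cdot)$ is the spectral radius; $P_A$ is the orthogonal projection onto $\overline{\mathcal{R}(A)}$; $A^\dagger$ is the Moore-Penrose inverse of a closed range operator $A$. A proper splitting of $T$ is a decomposition $T=U-V$ with $U,V\in\mathcal{L}(\mathcal{H})$, $\mathcal{R}(U)=\mathcal{R}(T)$, $\mathcal{N}(U)=\mathcal{N}(T)$; it converges if $\rho(U^\dagger V)<1$. Here $V=U_T-T$, $W=T_1-P_{T_2}-T$ and $Z=P_{T_1}-T_2-T$, the corresponding operators $U$ being $U_T$, $T_1-P_{T_2}$ and $P_{T_1}-T_2$. $U_T$ is the partial isometry of the polar decomposition $T=U_T|T|$, $|T|=(T^*T)^{1/2}$, $\mathcal{N}(U_T)=\mathcal{N}(T)$ (so $U_T^\dagger=U_T^*$). The positive orthogonal decomposition of $T\in\mathcal{L}^h$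 is the unique decomposition $T=T_1-T_2$ with $T_1,T_2\in\mathcal{L}^+$ and $\overline{\mathcal{R}(T_1)}\oplus\overline{\mathcal{R}(T_2)}=\overline{\mathcal{R}(T)}$ (orthogonal sum); explicitly $T_1=\frac{|T|+T}{2}$, $T_2=\frac{|T|-T}{2}$. *)

theory Defs
  imports "HOL-Analysis.Analysis"
begin

text \<open>
  A complex Hilbert space. The real structure (norm, topology, real inner product) comes from
  \<open>real_inner\<close> and is tied to the complex one by \<open>x \<bullet> y = Re \<langle>x, y\<rangle>\<close>, so that positive definiteness
  of the complex inner product and \<open>norm x = sqrt \<langle>x, x\<rangle>\<close> are consequences of the axioms of
  \<open>real_inner\<close>. The complex inner product is linear in its first argument.
\<close>

class chilbert_space = real_inner + complete_space +
  fixes scaleC :: "complex \<Rightarrow> 'a \<Rightarrow> 'a" (infixr "*\<^sub>C" 75)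
    and cinner :: "'a \<Rightarrow> 'a \<Rightarrow> complex"
  assumes scaleC_add_right: "c *\<^sub>C (x + y) = c *\<^sub>C x + c *\<^sub>C y"
    and scaleC_add_left: "(c + d) *\<^sub>C x = c *\<^sub>C x + d *\<^sub>C x"
    and scaleC_scaleC: "c *\<^sub>C (d *\<^sub>C x) = (c * d) *\<^sub>C x"
    and scaleC_of_real: "complex_of_real r *\<^sub>C x = r *\<^sub>R x"
    and cinner_commute: "cinner x y = cnj (cinner y x)"
    and cinner_add_left: "cinner (x + y) z = cinner x z + cinner y z"
    and cinner_scaleC_left: "cinner (c *\<^sub>C x) y = c * cinner x y"
    and inner_eq_Re_cinner: "x \<bullet> y = Re (cinner x y)"

instantiation complex :: chilbert_space
begin

definition scaleC_complex :: "complex \<Rightarrow> complex \<Rightarrow> complex"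
  where "scaleC_complex c z = c * z"

definition cinner_complex :: "complex \<Rightarrow> complex \<Rightarrow> complex"
  where "cinner_complex x y = x * cnj y"

instance
  by standard
    (auto simp: scaleC_complex_def cinner_complex_def algebra_simps inner_complex_def
      scaleR_conv_of_real)

end

text \<open>
  The algebra \<open>\<L>(\<H>)\<close>. The library type of bounded operators is the type of bounded
  real-linear ones; complex-linearity is imposed here.
\<close>

definition bounded_ops :: "('a::chilbert_space \<Rightarrow>\<^sub>L 'a) set"
  where "bounded_ops = {A. \<forall>c x. blinfun_apply A (c *\<^sub>C x) = c *\<^sub>C blinfun_apply A x}"

definition op_range :: "('a::chilbert_space \<Rightarrow>\<^sub>L 'a) \<Rightarrow> 'a set"
  where "op_range A = range (blinfun_apply A)"

definition op_null :: "('a::chilbert_space \<Rightarrow>\<^sub>L 'a) \<Rightarrow> 'a set"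
  where "op_null A = {x. blinfun_apply A x = 0}"

definition adjoint_op :: "('a::chilbert_space \<Rightarrow>\<^sub>L 'a) \<Rightarrow> ('a \<Rightarrow>\<^sub>L 'a)"
  where "adjoint_op A =
    (THE B. B \<in> bounded_ops \<and>
      (\<forall>x y. cinner (blinfun_apply A x) y = cinner x (blinfun_apply B y)))"

definition selfadjoint_op :: "('a::chilbert_space \<Rightarrow>\<^sub>L 'a) \<Rightarrow> bool"
  where "selfadjoint_op A \<longleftrightarrow> A \<in> bounded_ops \<and>
    (\<forall>x y. cinner (blinfun_apply A x) y = cinner x (blinfun_apply A y))"

definition positive_op :: "('a::chilbert_space \<Rightarrow>\<^sub>L 'a) \<Rightarrow> bool"
  where "positive_op A \<longleftrightarrow> selfadjoint_op A \<and> (\<forall>x. 0 \<le> Re (cinner (blinfun_apply A x) x))"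

definition spectrum_op :: "('a::chilbert_space \<Rightarrow>\<^sub>L 'a) \<Rightarrow> complex set"
  where "spectrum_op A =
    {c. \<not> (\<exists>B\<in>bounded_ops. \<forall>x.
          blinfun_apply B (blinfun_apply A x - c *\<^sub>C x) = x \<and>
          blinfun_apply A (blinfun_apply B x) - c *\<^sub>C blinfun_apply B x = x)}"

text \<open>
  The spectrum is empty only if the space is zero; inserting \<open>0\<close> makes the spectral
  radius \<open>0\<close> in that case and changes nothing otherwise.
\<close>

definition spectral_radius_op :: "('a::chilbert_space \<Rightarrow>\<^sub>L 'a) \<Rightarrow> real"
  where "spectral_radius_op A = Sup (insert 0 (cmod ` spectrum_op A))"

text \<open>\<open>range_proj A\<close> is \<open>P\<^sub>A\<close>, the orthogonal projection onto the closure of the range of \<open>A\<close>.\<close>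

definition range_proj :: "('a::chilbert_space \<Rightarrow>\<^sub>L 'a) \<Rightarrow> ('a \<Rightarrow>\<^sub>L 'a)"
  where "range_proj A =
    (THE P. selfadjoint_op P \<and> P o\<^sub>L P = P \<and> op_range P = closure (op_range A))"

text \<open>The Moore-Penrose inverse, by the four Penrose equations; meaningful for closed range.\<close>

definition pinv_op :: "('a::chilbert_space \<Rightarrow>\<^sub>L 'a) \<Rightarrow> ('a \<Rightarrow>\<^sub>L 'a)"
  where "pinv_op A =
    (THE X. X \<in> bounded_ops \<and> A o\<^sub>L X o\<^sub>L A = A \<and> X o\<^sub>L A o\<^sub>L X = X \<and>
      selfadjoint_op (A o\<^sub>L X) \<and> selfadjoint_op (X o\<^sub>L A))"

definition abs_op :: "('a::chilbert_space \<Rightarrow>\<^sub>L 'a) \<Rightarrow> ('a \<Rightarrow>\<^sub>L 'a)"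
  where "abs_op A = (THE B. positive_op B \<and> B o\<^sub>L B = adjoint_op A o\<^sub>L A)"

definition partial_isometry_op :: "('a::chilbert_space \<Rightarrow>\<^sub>L 'a) \<Rightarrow> bool"
  where "partial_isometry_op U \<longleftrightarrow> U \<in> bounded_ops \<and>
    (\<forall>x. (\<forall>y\<in>op_null U. cinner x y = 0) \<longrightarrow> norm (blinfun_apply U x) = norm x)"

definition polar_isometry :: "('a::chilbert_space \<Rightarrow>\<^sub>L 'a) \<Rightarrow> ('a \<Rightarrow>\<^sub>L 'a)"
  where "polar_isometry T =
    (THE U. partial_isometry_op U \<and> T = U o\<^sub>L abs_op T \<and> op_null U = op_null T)"

definition pos_orth_decomp ::
    "('a::chilbert_space \<Rightarrow>\<^sub>L 'a) \<Rightarrow> ('a \<Rightarrow>\<^sub>L 'a) \<Rightarrow> ('a \<Rightarrow>\<^sub>L 'a) \<Rightarrow> bool"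
  where "pos_orth_decomp T T1 T2 \<longleftrightarrow>
    positive_op T1 \<and> positive_op T2 \<and> T = T1 - T2 \<and>
    (\<forall>x\<in>closure (op_range T1). \<forall>y\<in>closure (op_range T2). cinner x y = 0) \<and>
    {x + y | x y. x \<in> closure (op_range T1) \<and> y \<in> closure (op_range T2)} =
      closure (op_range T)"

definition proper_splitting ::
    "('a::chilbert_space \<Rightarrow>\<^sub>L 'a) \<Rightarrow> ('a \<Rightarrow>\<^sub>L 'a) \<Rightarrow> ('a \<Rightarrow>\<^sub>L 'a) \<Rightarrow> bool"
  where "proper_splitting T U V \<longleftrightarrow>
    U \<in> bounded_ops \<and> V \<in> bounded_ops \<and> T = U - V \<and>
    op_range U = op_range T \<and> op_null U = op_null T"

definition convergent_splitting ::
    "('a::chilbert_space \<Rightarrow>\<^sub>L 'a) \<Rightarrow> ('a \<Rightarrow>\<^sub>L 'a) \<Rightarrow> ('a \<Rightarrow>\<^sub>L 'a) \<Rightarrow> bool"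
  where "convergent_splitting T U V \<longleftrightarrow>
    proper_splitting T U V \<and> spectral_radius_op (pinv_op U o\<^sub>L V) < 1"

end

theory Submission
  imports Defs
begin

text \<open>
  Let \<open>P1\<close>, \<open>P2\<close> be the range projections of \<open>T1\<close>, \<open>T2\<close>. The ranges of \<open>T1\<close> and \<open>T2\<close> are closed
  and orthogonal, so \<open>|T| = T1 + T2\<close> and \<open>U_T = P1 - P2\<close>, whence \<open>U_T\<^sup>* V = (P1 - T1) + (P2 - T2)\<close>.
  The other two iteration operators turn out to be exactly \<open>P2 - T2\<close> and \<open>P1 - T1\<close>.
  As their products vanish, the nonzero spectrum of the sum is the union of the nonzero spectra.
\<close>

subsection \<open>Hilbert space preliminaries\<close>

text \<open>Adjoint, range projection, pseudoinverse, absolute value and polar factor are all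
  definite descriptions, so each calls for a candidate and a uniqueness proof; most of the
  development supplies these. Projections and pseudoinverses are built pointwise as symmetric maps,
  and their uniqueness rests on one device: selfadjoint operators whose product is selfadjoint
  commute. For \<open>|T|\<close> and \<open>U_T\<close> the candidates are explicit, and
  \<open>|T|\<close> is pinned down by uniqueness of positive square roots. The iteration operators
  come out because \<open>W = T2 - P2\<close> has its range inside that of \<open>T2\<close>, where
  \<open>T1 - P2\<close> acts as minus the identity, while \<open>Z = P1 - T1\<close> has its range
  inside that of \<open>T1\<close>, where \<open>P1 - T2\<close> acts as the identity. A maximum is
  below 1 exactly when both entries are, which turns the formula for the radii into the
  equivalence.\<close>

lemma closest_point_exists:
  fixes x :: "'a::{real_inner, complete_space}"
  assumes "subspace M" "closed M"
  shows "\<exists>y\<in>M. \<forall>z\<in>M. norm (x - y) \<le> norm (x - z)"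
proof -
  define d where "d = Inf ((\<lambda>y. (norm (x - y))\<^sup>2) ` M)"
  have ne: "M \<noteq> {}" using assms(1) subspace_0 by auto
  have bdd: "bdd_below ((\<lambda>y. (norm (x - y))\<^sup>2) ` M)"
    by (rule bdd_belowI[where m = 0]) auto
  have d_le: "d \<le> (norm (x - y))\<^sup>2" if "y \<in> M" for y
    unfolding d_def using that bdd by (simp add: cInf_lower)
  have "\<exists>y\<in>M. (norm (x - y))\<^sup>2 < d + 1 / Suc n" for n
    using cInf_lessD[of "(\<lambda>y. (norm (x - y))\<^sup>2) ` M" "d + 1 / Suc n"] ne
    unfolding d_def by auto
  then obtain u where uM: "\<And>n. u n \<in> M" and u: "\<And>n. (norm (x - u n))\<^sup>2 < d + 1 / Suc n"
    by metis
  \<comment> \<open>Parallelogram law: the midpoint of two near-minimisers lies in \<open>M\<close>,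
    so its squared distance to \<open>x\<close> is at least \<open>d\<close>, and this forces the
    two points together.\<close>
  have par: "(norm (u m - u n))\<^sup>2 \<le> 2 * (1 / Suc m) + 2 * (1 / Suc n)" for m n
  proof -
    have "(1/2) *\<^sub>R (u m + u n) \<in> M"
      using assms(1) uM by (simp add: subspace_add subspace_scale)
    then have "d \<le> (norm (x - (1/2) *\<^sub>R (u m + u n)))\<^sup>2" by (rule d_le)
    moreover have "(norm (u m - u n))\<^sup>2 + 4 * (norm (x - (1/2) *\<^sub>R (u m + u n)))\<^sup>2
        = 2 * (norm (x - u m))\<^sup>2 + 2 * (norm (x - u n))\<^sup>2"
      by (simp add: power2_norm_eq_inner inner_diff inner_add inner_commute algebra_simps)
    ultimately show ?thesis using u[of m] u[of n] by linarith
  qed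
  have "Cauchy u"
  proof (rule metric_CauchyI)
    fix e :: real assume "e > 0"
    then obtain N where N: "1 / Suc N < e\<^sup>2 / 4"
      using nat_approx_posE[of "e\<^sup>2 / 4"] by auto
    have "dist (u m) (u n) < e" if "m \<ge> N" "n \<ge> N" for m n
    proof -
      have "1 / Suc m \<le> 1 / Suc N" "1 / Suc n \<le> 1 / Suc N"
        using that by (simp_all add: frac_le)
      then have "(norm (u m - u n))\<^sup>2 < e\<^sup>2" using par[of m n] N by simp
      then show ?thesis using \<open>e > 0\<close> by (simp add: dist_norm power2_less_imp_less)
    qed
    then show "\<exists>N. \<forall>m\<ge>N. \<forall>n\<ge>N. dist (u m) (u n) < e" by blast
  qed
  then obtain y where y: "u \<longlonglongrightarrow> y" using Cauchy_convergent convergent_def by blast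
  then have "y \<in> M" using assms(2) uM closed_sequentially by blast
  have "(norm (x - y))\<^sup>2 \<le> d + 0"
  proof (rule LIMSEQ_le)
    show "(\<lambda>n. (norm (x - u n))\<^sup>2) \<longlonglongrightarrow> (norm (x - y))\<^sup>2"
      by (intro tendsto_intros y)
    show "(\<lambda>n. d + 1 / Suc n) \<longlonglongrightarrow> d + 0"
      using LIMSEQ_inverse_real_of_nat by (intro tendsto_intros) (simp add: inverse_eq_divide)
    show "\<exists>N. \<forall>n\<ge>N. (norm (x - u n))\<^sup>2 \<le> d + 1 / Suc n"
      using u less_imp_le by blast
  qed
  then have "norm (x - y) \<le> norm (x - z)" if "z \<in> M" for z
    using d_le[OF that] by (simp add: power2_le_imp_le)
  then show ?thesis using \<open>y \<in> M\<close> by blast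
qed

lemma orthogonal_projection_exists:
  fixes x :: "'a::{real_inner, complete_space}"
  assumes "subspace M" "closed M"
  shows "\<exists>y\<in>M. \<forall>z\<in>M. (x - y) \<bullet> z = 0"
proof -
  obtain y where y: "y \<in> M" "\<And>z. z \<in> M \<Longrightarrow> norm (x - y) \<le> norm (x - z)"
    using closest_point_exists[OF assms] by blast
  have "(x - y) \<bullet> z = 0" if "z \<in> M" for z
  proof (cases "z = 0")
    case False
    \<comment> \<open>This \<open>t\<close> minimises the squared distance from \<open>x\<close> to
      \<open>y + t *\<^sub>R z\<close>, so any nonzero inner product would give a point of
      \<open>M\<close> closer than \<open>y\<close>.\<close>
    define t where "t = ((x - y) \<bullet> z) / (z \<bullet> z)"
    have "y + t *\<^sub>R z \<in> M" using y(1) that assms(1) by (simp add: subspace_add subspace_scale)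
    then have "(norm (x - y))\<^sup>2 \<le> (norm ((x - y) - t *\<^sub>R z))\<^sup>2"
      using y(2) by (simp add: diff_diff_add)
    also have "\<dots> = (norm (x - y))\<^sup>2 - 2 * t * ((x - y) \<bullet> z) + t\<^sup>2 * (z \<bullet> z)"
      unfolding power2_norm_eq_inner
      by (simp add: inner_diff inner_commute power2_eq_square algebra_simps)
    also have "\<dots> = (norm (x - y))\<^sup>2 - ((x - y) \<bullet> z)\<^sup>2 / (z \<bullet> z)"
      using False by (simp add: t_def power2_eq_square field_simps)
    finally have "((x - y) \<bullet> z)\<^sup>2 / (z \<bullet> z) \<le> 0" by simp
    moreover have "z \<bullet> z > 0" using False by simp
    ultimately have "((x - y) \<bullet> z)\<^sup>2 \<le> 0" by (simp add: divide_le_0_iff)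
    then show ?thesis by simp
  qed simp
  then show ?thesis using y(1) by blast
qed

text \<open>Uniform boundedness for the functionals given by inner product with \<open>S y\<close>,
  where \<open>y\<close> runs over the unit ball: symmetry bounds them pointwise by
  \<open>norm (S x)\<close>, and Baire category makes the bound uniform.\<close>

theorem Hellinger_Toeplitz:
  fixes S :: "'a::{real_inner, complete_space} \<Rightarrow> 'a"
  assumes "linear S" and sym: "\<And>x y. S x \<bullet> y = x \<bullet> S y"
  shows "bounded_linear S"
proof -
  \<comment> \<open>With \<open>S\<close> applied to \<open>y\<close> only, the condition is
    continuous in \<open>x\<close>, so \<open>F n\<close> is closed although continuity of
    \<open>S\<close> is still unknown.\<close>
  define F where "F n = {x. \<forall>y. norm y \<le> 1 \<longrightarrow> \<bar>x \<bullet> S y\<bar> \<le> real n}" for n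
  have "closed (F n)" for n
    unfolding F_def by (intro closed_Collect_all closed_Collect_imp closed_Collect_le
      open_Collect_const continuous_intros)
  moreover have "(\<Union>n. F n) = UNIV"
  proof -
    have "x \<in> F (nat \<lceil>norm (S x)\<rceil>)" for x
    proof -
      have "\<bar>x \<bullet> S y\<bar> \<le> real (nat \<lceil>norm (S x)\<rceil>)" if "norm y \<le> 1" for y
      proof -
        have "\<bar>x \<bullet> S y\<bar> \<le> norm (S x) * norm y"
          using sym[of x y] Cauchy_Schwarz_ineq2[of "S x" y] by simp
        also have "\<dots> \<le> norm (S x)" using that by (simp add: mult_left_le)
        finally show ?thesis by linarith
      qed
      then show ?thesis by (simp add: F_def)
    qed
    then show ?thesis by blast
  qed
  ultimately obtain n where "interior (F n) \<noteq> {}"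
    using Baire_category_alt[of "euclidean :: 'a topology" "range F"]
    by (auto simp: completely_metrizable_space_euclidean)
  then obtain a r where "r > 0" and r: "cball a r \<subseteq> F n"
    by (metis all_not_in_conv mem_interior_cball)
  have bound: "norm (S y) \<le> 2 * real n / r" if "norm y \<le> 1" for y
  proof (cases "S y = 0")
    case False
    \<comment> \<open>Pointing \<open>e\<close> along \<open>S y\<close> makes the inner product
      equal to \<open>r * norm (S y)\<close>; as a difference of two points of \<open>F n\<close> it
      is at most \<open>2 * n\<close>.\<close>
    define e where "e = (r / norm (S y)) *\<^sub>R S y"
    have "norm e = r" using False \<open>r > 0\<close> by (simp add: e_def)
    then have "a \<in> F n" "a + e \<in> F n" using r \<open>r > 0\<close> by (auto simp: dist_norm subset_eq)
    then have "\<bar>a \<bullet> S y\<bar> \<le> n" "\<bar>a \<bullet> S y + e \<bullet> S y\<bar> \<le> n"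
      using that by (auto simp: F_def inner_add_left)
    then have "e \<bullet> S y \<le> 2 * real n" by linarith
    moreover have "e \<bullet> S y = r * norm (S y)"
      using False by (simp add: e_def power2_norm_eq_inner[symmetric] power2_eq_square)
    ultimately show ?thesis using \<open>r > 0\<close> by (simp add: field_simps)
  qed (use \<open>r > 0\<close> in simp)
  interpret S: linear S by fact
  have "norm (S y) \<le> norm y * (2 * real n / r)" for y
  proof (cases "y = 0")
    case False
    have "norm (S ((1 / norm y) *\<^sub>R y)) \<le> 2 * real n / r"
      by (rule bound) (use False in simp)
    then show ?thesis using False by (simp add: S.scaleR field_simps)
  qed (simp add: S.zero)
  then show ?thesis
    by (intro bounded_linear_intro[where K = "2 * real n / r"] S.add S.scaleR)
qed

subsection \<open>Selfadjoint operators, range projections and pseudoinverses\<close>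

lemma scaleC_one: "1 *\<^sub>C x = (x :: 'a::chilbert_space)"
  using scaleC_of_real[of 1 x] by simp

lemma scaleC_zero_right: "c *\<^sub>C 0 = (0 :: 'a::chilbert_space)"
  using scaleC_add_right[of c 0 "0::'a"] by simp

lemma scaleC_minus_right: "c *\<^sub>C (- x) = - (c *\<^sub>C x :: 'a::chilbert_space)"
  using scaleC_add_right[of c x "- x"] by (simp add: scaleC_zero_right eq_neg_iff_add_eq_0 add.commute)

lemma scaleC_diff_right: "c *\<^sub>C (x - y) = c *\<^sub>C x - (c *\<^sub>C y :: 'a::chilbert_space)"
  using scaleC_add_right[of c x "- y"] by (simp add: scaleC_minus_right)

lemma scaleC_minus_left: "(- c) *\<^sub>C x = - (c *\<^sub>C x :: 'a::chilbert_space)"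
  using scaleC_scaleC[of "- 1" c x] scaleC_of_real[of "- 1" "c *\<^sub>C x"] by simp

lemma scaleC_scaleR_commute: "c *\<^sub>C (r *\<^sub>R x) = r *\<^sub>R (c *\<^sub>C x :: 'a::chilbert_space)"
  by (simp add: scaleC_of_real[symmetric] scaleC_scaleC mult.commute)

lemma cinner_scaleC_right: "cinner x (c *\<^sub>C y) = cnj c * cinner x y"
  by (metis cinner_commute cinner_scaleC_left complex_cnj_mult)

lemma cinner_add_right: "cinner x (y + z) = cinner x y + cinner x z"
  by (metis cinner_commute cinner_add_left complex_cnj_add)

text \<open>Multiplying the second argument by the imaginary unit moves the imaginary part into the
  real part. Facts about the real inner product thereby transfer to the complex one.\<close>

lemma cinner_eq_Complex: "cinner x y = Complex (x \<bullet> y) (x \<bullet> (\<i> *\<^sub>C y))"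
  by (simp add: complex_eq_iff inner_eq_Re_cinner cinner_scaleC_right)

lemma cinner_diff_left: "cinner (x - y) z = cinner x z - cinner y z"
  by (simp add: cinner_eq_Complex inner_diff_left complex_eq_iff)

lemma cinner_diff_right: "cinner x (y - z) = cinner x y - cinner x z"
  by (metis cinner_commute cinner_diff_left complex_cnj_diff)

lemma cinner_ext: "(\<And>z. cinner x z = cinner y z) \<Longrightarrow> x = y"
  by (metis inner_eq_Re_cinner vector_eq_rdot)

lemma norm_scaleC: "norm (c *\<^sub>C x) = cmod c * norm (x :: 'a::chilbert_space)"
proof -
  have "cinner x x = complex_of_real ((norm x)\<^sup>2)"
    using cinner_commute[of x x]
    by (simp add: complex_eq_iff power2_norm_eq_inner inner_eq_Re_cinner)
  then have "cinner (c *\<^sub>C x) (c *\<^sub>C x) = complex_of_real ((cmod c * norm x)\<^sup>2)"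
    using complex_norm_square[of c]
    by (simp add: cinner_scaleC_left cinner_scaleC_right power_mult_distrib mult_ac)
  then have "(norm (c *\<^sub>C x))\<^sup>2 = (cmod c * norm x)\<^sup>2"
    by (simp add: power2_norm_eq_inner inner_eq_Re_cinner)
  then show ?thesis by (simp add: power2_eq_iff_nonneg)
qed

section \<open>Closure properties of complex-linear and selfadjoint operators\<close>

lemma bounded_opsD: "A \<in> bounded_ops \<Longrightarrow> blinfun_apply A (c *\<^sub>C x) = c *\<^sub>C blinfun_apply A x"
  by (simp add: bounded_ops_def)

lemma bounded_ops_add: "A \<in> bounded_ops \<Longrightarrow> B \<in> bounded_ops \<Longrightarrow> A + B \<in> bounded_ops"
  by (simp add: bounded_ops_def blinfun.add_left scaleC_add_right)

lemma bounded_ops_diff: "A \<in> bounded_ops \<Longrightarrow> B \<in> bounded_ops \<Longrightarrow> A - B \<in> bounded_ops"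
  by (simp add: bounded_ops_def blinfun.diff_left scaleC_diff_right)

lemma bounded_ops_compose: "A \<in> bounded_ops \<Longrightarrow> B \<in> bounded_ops \<Longrightarrow> A o\<^sub>L B \<in> bounded_ops"
  by (simp add: bounded_ops_def)

lemma selfadjoint_op_in_bounded_ops: "selfadjoint_op A \<Longrightarrow> A \<in> bounded_ops"
  by (simp add: selfadjoint_op_def)

lemma selfadjoint_op_cinner:
  "selfadjoint_op A \<Longrightarrow> cinner (blinfun_apply A x) y = cinner x (blinfun_apply A y)"
  by (simp add: selfadjoint_op_def)

lemma selfadjoint_op_inner:
  "selfadjoint_op A \<Longrightarrow> blinfun_apply A x \<bullet> y = x \<bullet> blinfun_apply A y"
  by (simp add: selfadjoint_op_def inner_eq_Re_cinner)

lemma selfadjoint_op_add: "selfadjoint_op A \<Longrightarrow> selfadjoint_op B \<Longrightarrow> selfadjoint_op (A + B)"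
  by (simp add: selfadjoint_op_def bounded_ops_add blinfun.add_left cinner_add_left cinner_add_right)

lemma selfadjoint_op_diff: "selfadjoint_op A \<Longrightarrow> selfadjoint_op B \<Longrightarrow> selfadjoint_op (A - B)"
  by (simp add: selfadjoint_op_def bounded_ops_diff blinfun.diff_left cinner_diff_left cinner_diff_right)

lemma selfadjoint_op_zero: "selfadjoint_op 0"
  by (simp add: cinner_eq_Complex selfadjoint_op_def bounded_ops_def scaleC_zero_right)

lemma blinfun_compose_assoc: "(A o\<^sub>L B) o\<^sub>L C = A o\<^sub>L (B o\<^sub>L C)"
  by (rule blinfun_eqI) simp

text \<open>Taking adjoints reverses a product. The lemma serves to turn a known product such as
  \<open>0\<close>, or one of two projections, into the product in the other order.\<close>

lemma selfadjoint_op_compose_commute: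
  assumes "selfadjoint_op A" "selfadjoint_op B" "selfadjoint_op (A o\<^sub>L B)"
  shows "B o\<^sub>L A = A o\<^sub>L B"
proof (rule blinfun_eqI, rule cinner_ext)
  fix x z
  show "cinner (blinfun_apply (B o\<^sub>L A) x) z = cinner (blinfun_apply (A o\<^sub>L B) x) z"
    using selfadjoint_op_cinner[OF assms(1)] selfadjoint_op_cinner[OF assms(2)]
      selfadjoint_op_cinner[OF assms(3), of x z] by simp
qed

text \<open>By Hellinger-Toeplitz an everywhere defined symmetric map is automatically bounded, so
  operators can be constructed from their values alone.\<close>

lemma symmetric_imp_selfadjoint_op:
  fixes S :: "'a::chilbert_space \<Rightarrow> 'a"
  assumes sym: "\<And>x y. cinner (S x) y = cinner x (S y)"
  obtains A where "selfadjoint_op A" "blinfun_apply A = S"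
proof -
  have add: "S (x + y) = S x + S y" for x y
    by (rule cinner_ext) (simp add: sym cinner_add_left)
  have scale: "S (c *\<^sub>C x) = c *\<^sub>C S x" for c x
    by (rule cinner_ext) (simp add: sym cinner_scaleC_left)
  have "linear S"
    by (rule linearI) (use scale[of "complex_of_real _"] in \<open>simp_all add: add scaleC_of_real\<close>)
  then have "bounded_linear S"
    by (rule Hellinger_Toeplitz) (simp add: inner_eq_Re_cinner sym)
  then have "blinfun_apply (Blinfun S) = S" by (rule bounded_linear_Blinfun_apply)
  then show thesis
    using that[of "Blinfun S"] by (simp add: selfadjoint_op_def bounded_ops_def sym scale)
qed

lemma adjoint_op_selfadjoint:
  assumes "selfadjoint_op A"
  shows "adjoint_op A = A"
  unfolding adjoint_op_def
proof (rule the_equality)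
  fix B assume B: "B \<in> bounded_ops \<and>
    (\<forall>x y. cinner (blinfun_apply A x) y = cinner x (blinfun_apply B y))"
  have "cinner (blinfun_apply B y) x = cinner (blinfun_apply A y) x" for x y
    using B selfadjoint_op_cinner[OF assms] by (metis cinner_commute)
  then show "B = A" by (intro blinfun_eqI) (rule cinner_ext)
qed (use assms in \<open>auto simp: selfadjoint_op_def\<close>)

lemma blinfun_apply_in_op_range [simp]: "blinfun_apply A x \<in> op_range A"
  by (simp add: op_range_def)

lemma subspace_op_range: "subspace (op_range A)"
  unfolding op_range_def by (intro linear_subspace_image) (simp_all add: blinfun.bounded_linear_right bounded_linear.linear)

text \<open>The range of a complex-linear operator is stable under the imaginary unit, so real
  orthogonality to it already gives complex orthogonality.\<close>

lemma cinner_op_range_eq_0: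
  assumes "A \<in> bounded_ops" "\<And>z. z \<in> op_range A \<Longrightarrow> u \<bullet> z = 0" "z \<in> op_range A"
  shows "cinner u z = 0"
proof -
  have "\<i> *\<^sub>C z \<in> op_range A"
    using assms(1,3) bounded_opsD[OF assms(1), symmetric] by (auto simp: op_range_def)
  then show ?thesis using assms(2,3) by (simp add: cinner_eq_Complex zero_complex.code)
qed

lemma range_proj_closed_range:
  assumes "A \<in> bounded_ops" "closed (op_range A)"
  shows selfadjoint_range_proj: "selfadjoint_op (range_proj A)"
    and range_proj_idem: "range_proj A o\<^sub>L range_proj A = range_proj A"
    and op_range_range_proj: "op_range (range_proj A) = op_range A"
proof -
  let ?is_proj = "\<lambda>P. selfadjoint_op P \<and> P o\<^sub>L P = P \<and> op_range P = closure (op_range A)"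
  obtain p where p: "\<And>x. p x \<in> op_range A" "\<And>x z. z \<in> op_range A \<Longrightarrow> (x - p x) \<bullet> z = 0"
    using orthogonal_projection_exists[OF subspace_op_range assms(2)] by metis
  have orth: "cinner (x - p x) z = 0" if "z \<in> op_range A" for x z
    using cinner_op_range_eq_0[OF assms(1) p(2) that] by blast
  \<comment> \<open>Moving either argument to its nearest point changes nothing, so both sides of
    the symmetry equation equal \<open>cinner (p x) (p y)\<close>.\<close>
  have "cinner (p x) y = cinner (p x) (p y)" for x y
    using orth[OF p(1), of y x] cinner_commute[of "p x"]
    by (simp add: cinner_diff_left)
  moreover have "cinner x (p y) = cinner (p x) (p y)" for x y
    using orth[OF p(1), of x y] by (simp add: cinner_diff_left)
  ultimately obtain P where P: "selfadjoint_op P" "blinfun_apply P = p"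
    using symmetric_imp_selfadjoint_op[of p] by metis
  have fixp: "p x = x" if "x \<in> op_range A" for x
  proof -
    have "x - p x \<in> op_range A" using that p(1) subspace_op_range subspace_diff by blast
    then have "(x - p x) \<bullet> (x - p x) = 0" by (rule p(2))
    then show ?thesis by simp
  qed
  have "op_range P = op_range A"
  proof
    show "op_range P \<subseteq> op_range A" using p(1) by (auto simp: op_range_def[of P] P(2))
    show "op_range A \<subseteq> op_range P"
      using fixp blinfun_apply_in_op_range[of P] P(2) by (metis subsetI)
  qed
  moreover have "P o\<^sub>L P = P" by (rule blinfun_eqI) (simp add: P(2) fixp p(1))
  ultimately have ex: "?is_proj P" using P(1) assms(2) by simp
  \<comment> \<open>Each projection fixes the common range, so \<open>QP = P\<close> and
    \<open>PQ = Q\<close>; selfadjointness of \<open>P\<close> makes the factors commute.\<close>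
  have "Q = P" if Q: "?is_proj Q" for Q
  proof -
    have "blinfun_apply Q z = z" if "z \<in> op_range P" for z
    proof -
      have "z \<in> op_range Q" using that ex Q by simp
      then obtain x where "z = blinfun_apply Q x" by (auto simp: op_range_def)
      then show ?thesis using Q blinfun_apply_blinfun_compose[of Q Q x] by simp
    qed
    then have "Q o\<^sub>L P = P" by (intro blinfun_eqI) simp
    moreover have "P o\<^sub>L Q = Q"
    proof (rule blinfun_eqI)
      fix x
      have "blinfun_apply Q x \<in> op_range A"
        using Q assms(2) blinfun_apply_in_op_range[of Q x] by simp
      then show "blinfun_apply (P o\<^sub>L Q) x = blinfun_apply Q x" by (simp add: P(2) fixp)
    qed
    ultimately show ?thesis using selfadjoint_op_compose_commute[of Q P] Q ex by metis
  qed
  then have "?is_proj (range_proj A)"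
    unfolding range_proj_def using ex by (rule theI[where P = ?is_proj, rotated])
  then show "selfadjoint_op (range_proj A)" "range_proj A o\<^sub>L range_proj A = range_proj A"
    "op_range (range_proj A) = op_range A"
    using assms(2) by simp_all
qed

text \<open>Vanishing of a product depends on the right factor only through its range; commuting the
  selfadjoint factors gives the same for the left one. All mixed products of \<open>T1\<close>,
  \<open>P1\<close> with \<open>T2\<close>, \<open>P2\<close> thus vanish once
  \<open>T1 o\<^sub>L T2\<close> does.\<close>

lemma compose_eq_zero_cong:
  assumes "A o\<^sub>L B = 0" "selfadjoint_op A" "selfadjoint_op A'" "selfadjoint_op B" "selfadjoint_op B'"
    and "op_range A' = op_range A" "op_range B' = op_range B"
  shows "A' o\<^sub>L B' = 0"
proof -
  have vanish: "C o\<^sub>L D' = 0" if zero: "C o\<^sub>L D = 0" and range: "op_range D' = op_range D" for C D D' :: "'a \<Rightarrow>\<^sub>L 'a"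
  proof (rule blinfun_eqI)
    fix x
    obtain z where "blinfun_apply D' x = blinfun_apply D z"
      using range unfolding op_range_def by (metis rangeE rangeI)
    then show "blinfun_apply (C o\<^sub>L D') x = blinfun_apply 0 x"
      using arg_cong[OF zero, of "\<lambda>F. blinfun_apply F z"] by simp
  qed
  have "A o\<^sub>L B' = 0" by (rule vanish[OF assms(1,7)])
  then have "B' o\<^sub>L A = 0"
    using selfadjoint_op_compose_commute[of A B'] assms selfadjoint_op_zero by metis
  then have "B' o\<^sub>L A' = 0" by (rule vanish[OF _ assms(6)])
  then show ?thesis
    using selfadjoint_op_compose_commute[of B' A'] assms selfadjoint_op_zero by metis
qed

section \<open>Moore-Penrose inverses of selfadjoint operators with closed range\<close>

context
  fixes A :: "'a::chilbert_space \<Rightarrow>\<^sub>L 'a"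
  assumes sa: "selfadjoint_op A" and cl: "closed (op_range A)"
begin

lemma range_proj_compose: "range_proj A o\<^sub>L A = A"
proof (rule blinfun_eqI)
  fix x
  obtain z where "blinfun_apply A x = blinfun_apply (range_proj A) z"
    using op_range_range_proj[OF selfadjoint_op_in_bounded_ops[OF sa] cl]
    unfolding op_range_def by (metis rangeE rangeI)
  then show "blinfun_apply (range_proj A o\<^sub>L A) x = blinfun_apply A x"
    using range_proj_idem[OF selfadjoint_op_in_bounded_ops[OF sa] cl]
    by (metis blinfun_apply_blinfun_compose)
qed

lemma compose_range_proj: "A o\<^sub>L range_proj A = A"
  using selfadjoint_op_compose_commute[of "range_proj A" A] sa range_proj_compose
    selfadjoint_range_proj[OF selfadjoint_op_in_bounded_ops[OF sa] cl] by simp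

text \<open>The candidate sends \<open>x\<close> to the preimage of its projection
  \<open>?P x\<close> under \<open>A\<close> that lies in the range of \<open>A\<close>. Symmetry of
  this map makes it a bounded operator.\<close>

lemma ex_pinv:
  obtains X where "X \<in> bounded_ops" "A o\<^sub>L X o\<^sub>L A = A" "X o\<^sub>L A o\<^sub>L X = X"
    "selfadjoint_op (A o\<^sub>L X)" "selfadjoint_op (X o\<^sub>L A)"
proof -
  note bd = selfadjoint_op_in_bounded_ops[OF sa]
  let ?P = "range_proj A"
  have PA: "blinfun_apply ?P (blinfun_apply A x) = blinfun_apply A x"
    and AP: "blinfun_apply A (blinfun_apply ?P x) = blinfun_apply A x"
    and PP: "blinfun_apply ?P (blinfun_apply ?P x) = blinfun_apply ?P x" for x
    using range_proj_compose compose_range_proj range_proj_idem[OF bd cl]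
    by (metis blinfun_apply_blinfun_compose)+
  \<comment> \<open>The kernel of the selfadjoint \<open>A\<close> is orthogonal to its range, so
    \<open>x - y\<close> projects to zero.\<close>
  have inj: "blinfun_apply ?P x = blinfun_apply ?P y"
    if "blinfun_apply A x = blinfun_apply A y" for x y
  proof -
    obtain z where z: "blinfun_apply ?P (x - y) = blinfun_apply A z"
      using op_range_range_proj[OF bd cl] unfolding op_range_def by (metis rangeE rangeI)
    have "blinfun_apply ?P (x - y) \<bullet> blinfun_apply ?P (x - y)
        = (x - y) \<bullet> blinfun_apply ?P (blinfun_apply ?P (x - y))"
      by (simp add: selfadjoint_op_inner[OF selfadjoint_range_proj[OF bd cl]])
    also have "\<dots> = (x - y) \<bullet> blinfun_apply A z" using PP[of "x - y"] by (simp add: z)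
    also have "\<dots> = 0"
      using that by (simp add: selfadjoint_op_inner[OF sa, symmetric] blinfun.diff_right)
    finally show ?thesis by (simp add: blinfun.diff_right)
  qed
  have "\<exists>y. blinfun_apply A y = blinfun_apply ?P x \<and> blinfun_apply ?P y = y" for x
    using op_range_range_proj[OF bd cl] AP PP unfolding op_range_def by (metis rangeE rangeI)
  then obtain s where s: "\<And>x. blinfun_apply A (s x) = blinfun_apply ?P x"
    "\<And>x. blinfun_apply ?P (s x) = s x" by metis
  \<comment> \<open>Both sides equal the inner product of \<open>A (s x)\<close> with
    \<open>s y\<close>, after inserting \<open>?P\<close>, which fixes the values of
    \<open>s\<close>.\<close>
  have "cinner (s x) y = cinner x (s y)" for x y
    using selfadjoint_op_cinner[OF sa, of "s x" "s y"]
      selfadjoint_op_cinner[OF selfadjoint_range_proj[OF bd cl], of "s x" y]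
      selfadjoint_op_cinner[OF selfadjoint_range_proj[OF bd cl], of x "s y"] by (simp add: s)
  then obtain X where X: "selfadjoint_op X" "blinfun_apply X = s"
    by (rule symmetric_imp_selfadjoint_op)
  have AX: "A o\<^sub>L X = ?P" by (rule blinfun_eqI) (simp add: X(2) s)
  have "s (blinfun_apply A x) = blinfun_apply ?P x" for x
    using inj[of "s (blinfun_apply A x)" x] s PA by simp
  then have XA: "X o\<^sub>L A = ?P" by (intro blinfun_eqI) (simp add: X(2))
  show thesis
  proof (rule that[of X])
    show "X \<in> bounded_ops" using X(1) by (rule selfadjoint_op_in_bounded_ops)
    show "A o\<^sub>L X o\<^sub>L A = A" by (simp add: AX range_proj_compose)
    show "X o\<^sub>L A o\<^sub>L X = X" unfolding XA by (rule blinfun_eqI) (simp add: X(2) s)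
    show "selfadjoint_op (A o\<^sub>L X)" "selfadjoint_op (X o\<^sub>L A)"
      by (simp_all add: AX XA selfadjoint_range_proj[OF bd cl])
  qed
qed

end

text \<open>For two solutions, \<open>AX\<close> and \<open>AY\<close> are selfadjoint projections
  onto the range of \<open>A\<close>, hence equal, and likewise \<open>XA = YA\<close>. Then
  \<open>X = XAX = XAY = YAY = Y\<close>.\<close>

lemma pinv_op_eqI:
  assumes "X \<in> bounded_ops" "A o\<^sub>L X o\<^sub>L A = A" "X o\<^sub>L A o\<^sub>L X = X"
    "selfadjoint_op (A o\<^sub>L X)" "selfadjoint_op (X o\<^sub>L A)"
  shows "pinv_op A = X"
  unfolding pinv_op_def
proof (rule the_equality)
  fix Y assume Y: "Y \<in> bounded_ops \<and> A o\<^sub>L Y o\<^sub>L A = A \<and> Y o\<^sub>L A o\<^sub>L Y = Y \<and>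
      selfadjoint_op (A o\<^sub>L Y) \<and> selfadjoint_op (Y o\<^sub>L A)"
  have "(A o\<^sub>L X) o\<^sub>L (A o\<^sub>L Y) = A o\<^sub>L Y" "(A o\<^sub>L Y) o\<^sub>L (A o\<^sub>L X) = A o\<^sub>L X"
    using assms(2) Y by (metis blinfun_compose_assoc)+
  then have right: "A o\<^sub>L X = A o\<^sub>L Y"
    using selfadjoint_op_compose_commute[of "A o\<^sub>L X" "A o\<^sub>L Y"] assms(4) Y by metis
  have "(X o\<^sub>L A) o\<^sub>L (Y o\<^sub>L A) = X o\<^sub>L A" "(Y o\<^sub>L A) o\<^sub>L (X o\<^sub>L A) = Y o\<^sub>L A"
    using assms(2) Y by (metis blinfun_compose_assoc)+
  then have left: "X o\<^sub>L A = Y o\<^sub>L A"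
    using selfadjoint_op_compose_commute[of "X o\<^sub>L A" "Y o\<^sub>L A"] assms(5) Y by metis
  show "Y = X" using right left assms(3) Y by (metis blinfun_compose_assoc)
qed (use assms in blast)

text \<open>The projection \<open>XA\<close> commutes with \<open>A\<close>. Consequently the
  pseudoinverse can be cancelled against \<open>A\<close> on any operator with values in the range
  of \<open>A\<close>, and no formula for it has to be computed.\<close>

lemma pinv_op_compose_self:
  assumes "selfadjoint_op A" "closed (op_range A)"
  shows "pinv_op A o\<^sub>L A o\<^sub>L A = A"
proof -
  obtain X where X: "X \<in> bounded_ops" "A o\<^sub>L X o\<^sub>L A = A" "X o\<^sub>L A o\<^sub>L X = X"
    "selfadjoint_op (A o\<^sub>L X)" "selfadjoint_op (X o\<^sub>L A)"
    using ex_pinv[OF assms] by blast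
  have "A o\<^sub>L (X o\<^sub>L A) = A" using X(2) by (simp add: blinfun_compose_assoc)
  then have "(X o\<^sub>L A) o\<^sub>L A = A"
    using selfadjoint_op_compose_commute[OF assms(1) X(5)] assms(1) by simp
  then show ?thesis using pinv_op_eqI[OF X] by simp
qed

subsection \<open>Positive square roots\<close>

lemma blinfun_eq_iff: "A = B \<longleftrightarrow> (\<forall>x. blinfun_apply A x = blinfun_apply B x)"
  by (auto intro: blinfun_eqI)

lemma positive_opD:
  assumes "positive_op A"
  shows "selfadjoint_op A" "0 \<le> blinfun_apply A x \<bullet> x"
  using assms by (simp_all add: positive_op_def inner_eq_Re_cinner)

text \<open>The quadratic form of \<open>B\<close> is nonnegative at
  \<open>x - t *\<^sub>R y\<close> with \<open>y = B x\<close>. This converts smallness of the form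
  at \<open>x\<close> into smallness of \<open>B x\<close>.\<close>

lemma positive_op_norm_le:
  assumes "positive_op B"
  shows "(norm (blinfun_apply B x))\<^sup>2 \<le> norm B * (blinfun_apply B x \<bullet> x)"
proof (cases "norm B = 0")
  case False
  \<comment> \<open>This value minimises the upper bound, quadratic in \<open>t\<close>, that is
    reached below.\<close>
  define t where "t = 1 / norm B"
  define y where "y = blinfun_apply B x"
  have "0 \<le> blinfun_apply B (x - t *\<^sub>R y) \<bullet> (x - t *\<^sub>R y)"
    by (rule positive_opD[OF assms])
  also have "\<dots> = y \<bullet> x - 2 * t * (norm y)\<^sup>2 + t\<^sup>2 * (blinfun_apply B y \<bullet> y)"
    using selfadjoint_op_inner[OF positive_opD(1)[OF assms], of y x]
    unfolding power2_norm_eq_inner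
    by (simp add: y_def blinfun.diff_right blinfun.scaleR_right inner_diff power2_eq_square inner_commute algebra_simps)
  also have "\<dots> \<le> y \<bullet> x - 2 * t * (norm y)\<^sup>2 + t\<^sup>2 * (norm B * (norm y)\<^sup>2)"
  proof -
    have "blinfun_apply B y \<bullet> y \<le> norm (blinfun_apply B y) * norm y" by (rule norm_cauchy_schwarz)
    also have "\<dots> \<le> norm B * norm y * norm y"
      by (intro mult_right_mono norm_blinfun norm_ge_zero)
    finally have "blinfun_apply B y \<bullet> y \<le> norm B * (norm y)\<^sup>2"
      by (simp add: power2_eq_square mult.assoc)
    then show ?thesis by (intro add_left_mono mult_left_mono) simp_all
  qed
  also have "\<dots> = y \<bullet> x - (norm y)\<^sup>2 / norm B"
    using False by (simp add: t_def power2_eq_square field_simps)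
  finally have "(norm y)\<^sup>2 / norm B \<le> y \<bullet> x" by simp
  then show ?thesis using False by (simp add: y_def field_simps)
qed simp

text \<open>For \<open>D = B - C\<close> with \<open>B\<^sup>2 = C\<^sup>2\<close> one has \<open>BD = - DC\<close>. On an approximate eigenvector of
  \<open>D\<^sup>2\<close> this forces both \<open>B\<close> and \<open>C\<close>, hence \<open>D\<close>, to be small.\<close>

lemma positive_op_small:
  assumes B: "positive_op B" and C: "positive_op C" and D: "selfadjoint_op D"
    and BD: "\<And>x. blinfun_apply B (blinfun_apply D x) = - blinfun_apply D (blinfun_apply C x)"
    and x: "norm x = 1"
  shows "r\<^sup>2 * (norm (blinfun_apply B x))\<^sup>2
    \<le> (norm B)\<^sup>2 * norm (blinfun_apply D (blinfun_apply D x) - r\<^sup>2 *\<^sub>R x)"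
proof -
  define e where "e = blinfun_apply D (blinfun_apply D x) - r\<^sup>2 *\<^sub>R x"
  let ?b = "blinfun_apply B x \<bullet> x"
  \<comment> \<open>Positivity of \<open>C\<close> makes this nonpositive, whereas replacing
    \<open>D (D x)\<close> by \<open>r\<^sup>2 *\<^sub>R x\<close> would make it nonnegative; so the
    form of \<open>B\<close> at \<open>x\<close> is controlled by the error
    \<open>e\<close>.\<close>
  have "blinfun_apply B (blinfun_apply D (blinfun_apply D x)) \<bullet> x
      = - (blinfun_apply C (blinfun_apply D x) \<bullet> blinfun_apply D x)"
    by (simp add: BD selfadjoint_op_inner[OF D])
  then have "blinfun_apply B (blinfun_apply D (blinfun_apply D x)) \<bullet> x \<le> 0"
    using positive_opD(2)[OF C] by simp
  moreover have "blinfun_apply D (blinfun_apply D x) = e + r\<^sup>2 *\<^sub>R x" by (simp add: e_def)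
  ultimately have "r\<^sup>2 * ?b \<le> - (blinfun_apply B e \<bullet> x)"
    by (simp add: blinfun.add_right blinfun.scaleR_right inner_add_left)
  also have "\<dots> \<le> norm (blinfun_apply B e)"
    using Cauchy_Schwarz_ineq2[of "blinfun_apply B e" x] x by simp
  also have "\<dots> \<le> norm B * norm e" by (rule norm_blinfun)
  finally have *: "r\<^sup>2 * ?b \<le> norm B * norm e" .
  have "r\<^sup>2 * (norm (blinfun_apply B x))\<^sup>2 \<le> r\<^sup>2 * (norm B * ?b)"
    by (intro mult_left_mono positive_op_norm_le[OF B]) simp
  also have "\<dots> = norm B * (r\<^sup>2 * ?b)" by simp
  also have "\<dots> \<le> norm B * (norm B * norm e)" by (intro mult_left_mono * norm_ge_zero)
  finally show ?thesis by (simp add: e_def power2_eq_square mult.assoc)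
qed

lemma approximate_norm_attained:
  fixes D :: "'a::real_normed_vector \<Rightarrow>\<^sub>L 'b::real_normed_vector"
  assumes "D \<noteq> 0"
  obtains x where "\<And>n. norm (x n) = 1" "(\<lambda>n. norm (blinfun_apply D (x n))) \<longlonglongrightarrow> norm D"
proof -
  have "\<exists>x. norm x = 1 \<and> norm D - 1 / Suc n \<le> norm (blinfun_apply D x)" for n
  \<comment> \<open>In the first case any unit vector works; in the second
    \<open>norm D - 1 / Suc n\<close> is a positive candidate for an operator bound.\<close>
  proof (cases "norm D \<le> 1 / Suc n")
    case True
    obtain z where "blinfun_apply D z \<noteq> 0"
      using assms by (metis blinfun_eqI zero_blinfun.rep_eq)
    then have "norm ((1 / norm z) *\<^sub>R z) = 1" by auto
    moreover have "norm D - 1 / Suc n \<le> norm (blinfun_apply D ((1 / norm z) *\<^sub>R z))"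
      using True by (meson diff_le_0_iff_le norm_ge_zero order_trans)
    ultimately show ?thesis by blast
  next
    case False
    have "\<exists>z. norm (blinfun_apply D z) > (norm D - 1 / Suc n) * norm z"
    proof (rule ccontr)
      assume "\<not> ?thesis"
      then have "norm D \<le> norm D - 1 / Suc n"
        using False by (intro norm_blinfun_bound) (auto simp: not_less)
      then show False by (simp add: field_simps)
    qed
    then obtain z where z: "norm (blinfun_apply D z) > (norm D - 1 / Suc n) * norm z" by blast
    then have "z \<noteq> 0" by auto
    then have "norm ((1 / norm z) *\<^sub>R z) = 1"
      "norm D - 1 / Suc n \<le> norm (blinfun_apply D ((1 / norm z) *\<^sub>R z))"
      using z by (simp_all add: blinfun.scaleR_right pos_le_divide_eq)
    then show ?thesis by blast
  qed
  then obtain x where x: "\<And>n. norm (x n) = 1"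
    "\<And>n. norm D - 1 / Suc n \<le> norm (blinfun_apply D (x n))" by metis
  have "(\<lambda>n. norm (blinfun_apply D (x n))) \<longlonglongrightarrow> norm D"
  proof (rule tendsto_sandwich[where h = "\<lambda>_. norm D"])
    show "\<forall>\<^sub>F n in sequentially. norm (blinfun_apply D (x n)) \<le> norm D"
      using norm_blinfun[of D "x _"] x(1) by simp
    show "(\<lambda>n. norm D - 1 / Suc n) \<longlonglongrightarrow> norm D"
      using tendsto_diff[OF tendsto_const LIMSEQ_inverse_real_of_nat, of "norm D"]
      by (simp add: inverse_eq_divide)
  qed (use x(2) in auto)
  then show thesis using that x(1) by blast
qed

text \<open>\<open>D\<^sup>2\<close> may have no eigenvector for \<open>r\<^sup>2\<close>, the
  square of \<open>norm D\<close>. Unit vectors along which the norm of \<open>D\<close> is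
  approached take its place, and in the limit \<open>r\<close> is forced to be zero.\<close>

lemma positive_sqrt_unique:
  assumes B: "positive_op B" and C: "positive_op C" and eq: "B o\<^sub>L B = C o\<^sub>L C"
  shows "B = C"
proof (rule ccontr)
  assume "B \<noteq> C"
  define D where "D = B - C"
  define r where "r = norm D"
  have "D \<noteq> 0" using \<open>B \<noteq> C\<close> by (simp add: D_def)
  then obtain x where x: "\<And>n. norm (x n) = 1"
    and lim: "(\<lambda>n. norm (blinfun_apply D (x n))) \<longlonglongrightarrow> r"
    unfolding r_def using approximate_norm_attained by metis
  have D: "selfadjoint_op D"
    unfolding D_def using B C by (intro selfadjoint_op_diff positive_opD(1))
  have sq: "blinfun_apply B (blinfun_apply B z) = blinfun_apply C (blinfun_apply C z)" for z
    using eq by (metis blinfun_apply_blinfun_compose)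
  have BD: "blinfun_apply B (blinfun_apply D z) = - blinfun_apply D (blinfun_apply C z)"
    and CD: "blinfun_apply C (blinfun_apply D z) = - blinfun_apply D (blinfun_apply B z)" for z
    by (simp_all add: D_def blinfun.diff_left blinfun.diff_right sq)
  define e where "e n = norm (blinfun_apply D (blinfun_apply D (x n)) - r\<^sup>2 *\<^sub>R x n)" for n
  define h where "h n = 2 * r\<^sup>2 * (r\<^sup>2 - (norm (blinfun_apply D (x n)))\<^sup>2)" for n
  \<comment> \<open>Expand the square and bound \<open>norm (D (D (x n)))\<close> by
    \<open>r\<^sup>2\<close>; what is left is \<open>h n\<close>, which tends to zero.\<close>
  have e_le: "(e n)\<^sup>2 \<le> h n" for n
  proof -
    have "norm (blinfun_apply D (blinfun_apply D (x n))) \<le> r * norm (blinfun_apply D (x n))"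
      unfolding r_def by (rule norm_blinfun)
    also have "\<dots> \<le> r * r"
      using norm_blinfun[of D "x n"] x by (intro mult_left_mono) (simp_all add: r_def)
    finally have "(norm (blinfun_apply D (blinfun_apply D (x n))))\<^sup>2 \<le> (r * r)\<^sup>2"
      by (simp add: power_mono)
    moreover have "(e n)\<^sup>2 = (norm (blinfun_apply D (blinfun_apply D (x n))))\<^sup>2
        - 2 * r\<^sup>2 * (norm (blinfun_apply D (x n)))\<^sup>2 + r\<^sup>2 * r\<^sup>2 * (norm (x n))\<^sup>2"
      unfolding e_def power2_norm_eq_inner
      using selfadjoint_op_inner[OF D, of "blinfun_apply D (x n)" "x n"]
      by (simp add: inner_diff inner_commute algebra_simps)
    ultimately show ?thesis by (simp add: h_def x power2_eq_square algebra_simps)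
  qed
  have "h \<longlonglongrightarrow> 2 * r\<^sup>2 * (r\<^sup>2 - r\<^sup>2)"
    unfolding h_def by (intro tendsto_intros lim)
  then have "h \<longlonglongrightarrow> 0" by simp
  then have "(\<lambda>n. (e n)\<^sup>2) \<longlonglongrightarrow> 0"
    by (rule tendsto_sandwich[OF _ _ tendsto_const, rotated 2]) (simp_all add: e_le)
  then have e0: "e \<longlonglongrightarrow> 0" by simp
  let ?K = "2 * ((norm B)\<^sup>2 + (norm C)\<^sup>2)"
  have bound: "r\<^sup>2 * (norm (blinfun_apply D (x n)))\<^sup>2 \<le> ?K * e n" for n
  proof -
    have "norm (blinfun_apply D (x n)) \<le> norm (blinfun_apply B (x n)) + norm (blinfun_apply C (x n))"
      by (simp add: D_def blinfun.diff_left norm_triangle_ineq4)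
    then have "(norm (blinfun_apply D (x n)))\<^sup>2
        \<le> (norm (blinfun_apply B (x n)) + norm (blinfun_apply C (x n)))\<^sup>2"
      by (simp add: power_mono)
    also have "\<dots> \<le> 2 * (norm (blinfun_apply B (x n)))\<^sup>2 + 2 * (norm (blinfun_apply C (x n)))\<^sup>2"
      using sum_squares_bound[of "norm (blinfun_apply B (x n))" "norm (blinfun_apply C (x n))"]
      by (simp add: power2_sum)
    finally have "r\<^sup>2 * (norm (blinfun_apply D (x n)))\<^sup>2 \<le> r\<^sup>2 *
        (2 * (norm (blinfun_apply B (x n)))\<^sup>2 + 2 * (norm (blinfun_apply C (x n)))\<^sup>2)"
      by (intro mult_left_mono) simp_all
    also have "\<dots> \<le> ?K * e n"
      using positive_op_small[OF B C D BD x, of r n] positive_op_small[OF C B D CD x, of r n]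
      by (simp add: e_def algebra_simps)
    finally show ?thesis .
  qed
  have "r\<^sup>2 * r\<^sup>2 \<le> ?K * 0"
  proof (rule LIMSEQ_le)
    show "(\<lambda>n. r\<^sup>2 * (norm (blinfun_apply D (x n)))\<^sup>2) \<longlonglongrightarrow> r\<^sup>2 * r\<^sup>2"
      by (intro tendsto_intros lim)
    show "(\<lambda>n. ?K * e n) \<longlonglongrightarrow> ?K * 0" by (intro tendsto_intros e0)
  qed (use bound in blast)
  then have "r = 0" by (simp add: zero_compare_simps)
  then show False using \<open>D \<noteq> 0\<close> by (simp add: r_def)
qed

lemma abs_op_eqI:
  assumes "selfadjoint_op A" "positive_op B" "B o\<^sub>L B = A o\<^sub>L A"
  shows "abs_op A = B"
  unfolding abs_op_def adjoint_op_selfadjoint[OF assms(1)]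
proof (rule the_equality)
  show "positive_op B \<and> B o\<^sub>L B = A o\<^sub>L A" using assms(2,3) by simp
  show "C = B" if "positive_op C \<and> C o\<^sub>L C = A o\<^sub>L A" for C
    by (rule positive_sqrt_unique) (use that assms(2,3) in simp_all)
qed

subsection \<open>Spectrum and spectral radius\<close>

definition scalar_op :: "complex \<Rightarrow> 'a::chilbert_space \<Rightarrow>\<^sub>L 'a"
  where "scalar_op c = Blinfun (\<lambda>x. c *\<^sub>C x)"

lemma scalar_op_apply [simp]: "blinfun_apply (scalar_op c) x = c *\<^sub>C x"
proof -
  have "bounded_linear (\<lambda>x::'a. c *\<^sub>C x)"
    by (rule bounded_linear_intro[where K = "cmod c"])
      (simp_all add: scaleC_add_right scaleC_scaleR_commute norm_scaleC)
  then show ?thesis unfolding scalar_op_def by (simp add: bounded_linear_Blinfun_apply)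
qed

lemma scalar_op_in_bounded_ops: "scalar_op c \<in> bounded_ops"
  by (simp add: bounded_ops_def scaleC_scaleC mult.commute)

definition invertible_op :: "('a::chilbert_space \<Rightarrow>\<^sub>L 'a) \<Rightarrow> bool"
  where "invertible_op K \<longleftrightarrow>
    (\<exists>B\<in>bounded_ops. B o\<^sub>L K = id_blinfun \<and> K o\<^sub>L B = id_blinfun)"

lemma spectrum_op_iff: "c \<in> spectrum_op A \<longleftrightarrow> \<not> invertible_op (A - scalar_op c)"
  unfolding spectrum_op_def invertible_op_def blinfun_eq_iff
  by (simp add: blinfun.diff_left all_conj_distrib)

lemma invertible_op_compose:
  assumes "invertible_op K" "invertible_op L"
  shows "invertible_op (K o\<^sub>L L)"
proof -
  obtain B C where "B \<in> bounded_ops" "C \<in> bounded_ops"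
    "\<And>x. blinfun_apply B (blinfun_apply K x) = x" "\<And>x. blinfun_apply K (blinfun_apply B x) = x"
    "\<And>x. blinfun_apply C (blinfun_apply L x) = x" "\<And>x. blinfun_apply L (blinfun_apply C x) = x"
    using assms unfolding invertible_op_def blinfun_eq_iff by auto
  then show ?thesis
    unfolding invertible_op_def blinfun_eq_iff
    by (intro bexI[of _ "C o\<^sub>L B"] bounded_ops_compose) simp_all
qed

text \<open>If \<open>B\<close> inverts \<open>KL = LK\<close>, then \<open>BL\<close> is a left
  inverse and \<open>LB\<close> a right inverse of \<open>K\<close>, and a left and a right inverse
  coincide.\<close>

lemma invertible_op_composeD:
  assumes "invertible_op (K o\<^sub>L L)" "K o\<^sub>L L = L o\<^sub>L K" "K \<in> bounded_ops" "L \<in> bounded_ops"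
  shows "invertible_op K"
proof -
  obtain B where B: "B \<in> bounded_ops" "\<And>x. blinfun_apply B (blinfun_apply K (blinfun_apply L x)) = x"
    "\<And>x. blinfun_apply K (blinfun_apply L (blinfun_apply B x)) = x"
    using assms(1) unfolding invertible_op_def blinfun_eq_iff by auto
  have comm: "blinfun_apply L (blinfun_apply K x) = blinfun_apply K (blinfun_apply L x)" for x
    using assms(2) by (metis blinfun_apply_blinfun_compose)
  have left: "blinfun_apply B (blinfun_apply L (blinfun_apply K x)) = x" for x
    by (simp add: comm B)
  have "blinfun_apply L (blinfun_apply B (blinfun_apply K x)) = x" for x
    using left[of "blinfun_apply L (blinfun_apply B (blinfun_apply K x))"] left[of x]
      comm B(3) by metis
  then show ?thesis
    unfolding invertible_op_def blinfun_eq_iff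
    using assms(4) B by (intro bexI[of _ "L o\<^sub>L B"] bounded_ops_compose) simp_all
qed

text \<open>\<open>A - c\<close> is bounded below by \<open>cmod c - norm A\<close>, which gives
  injectivity and a bound on the inverse. Surjectivity comes from Banach's fixed point
  theorem.\<close>

lemma norm_less_imp_notin_spectrum:
  assumes A: "A \<in> bounded_ops" and c: "norm A < cmod c"
  shows "c \<notin> spectrum_op A"
proof -
  let ?K = "A - scalar_op c"
  have "c \<noteq> 0" using c norm_ge_zero[of A] by (auto simp del: norm_ge_zero)
  have lower: "(cmod c - norm A) * norm x \<le> norm (blinfun_apply ?K x)" for x
  proof -
    have "cmod c * norm x - norm (blinfun_apply A x) \<le> norm (blinfun_apply ?K x)"
      using norm_triangle_ineq2[of "c *\<^sub>C x" "blinfun_apply A x"]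
      by (simp add: blinfun.diff_left norm_scaleC norm_minus_commute)
    then show ?thesis using norm_blinfun[of A x] by (simp add: left_diff_distrib)
  qed
  have "\<exists>x. blinfun_apply ?K x = y" for y
  proof -
    \<comment> \<open>A fixed point of this map solves \<open>A x - c *\<^sub>C x = y\<close>; the
      contraction factor \<open>norm A / cmod c\<close> is below 1.\<close>
    let ?f = "\<lambda>x. inverse c *\<^sub>C (blinfun_apply A x - y)"
    have "dist (?f u) (?f v) \<le> norm A / cmod c * dist u v" for u v
    proof -
      have "?f u - ?f v = inverse c *\<^sub>C blinfun_apply A (u - v)"
        by (simp add: scaleC_diff_right[symmetric] blinfun.diff_right)
      then have "dist (?f u) (?f v) = norm (blinfun_apply A (u - v)) / cmod c"
        by (simp add: dist_norm norm_scaleC norm_inverse divide_inverse mult.commute)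
      also have "\<dots> \<le> norm A * norm (u - v) / cmod c"
        by (intro divide_right_mono norm_blinfun norm_ge_zero)
      finally show ?thesis by (simp add: dist_norm)
    qed
    then obtain x where "?f x = x"
      using banach_fix_type[of "norm A / cmod c" ?f] c \<open>c \<noteq> 0\<close> by auto
    then have "c *\<^sub>C ?f x = c *\<^sub>C x" by simp
    then have "blinfun_apply ?K x = y"
      using \<open>c \<noteq> 0\<close> by (simp add: scaleC_scaleC scaleC_one blinfun.diff_left algebra_simps)
    then show ?thesis by blast
  qed
  then obtain g where Kg: "\<And>y. blinfun_apply ?K (g y) = y" by metis
  have inj: "x = y" if "blinfun_apply ?K x = blinfun_apply ?K y" for x y
  proof -
    have "(cmod c - norm A) * norm (x - y) \<le> 0"
      using lower[of "x - y"] that by (simp add: blinfun.diff_right)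
    then show ?thesis using c by (simp add: mult_le_0_iff)
  qed
  have K: "?K \<in> bounded_ops" using A by (simp add: bounded_ops_diff scalar_op_in_bounded_ops)
  have scale: "g (d *\<^sub>C y) = d *\<^sub>C g y" for d y
    by (rule inj) (simp only: Kg bounded_opsD[OF K])
  have lin: "bounded_linear g"
  proof (rule bounded_linear_intro)
    show "g (x + y) = g x + g y" for x y by (rule inj) (simp only: Kg blinfun.add_right)
    show "g (r *\<^sub>R x) = r *\<^sub>R g x" for r x using scale[of "complex_of_real r" x]
      by (simp add: scaleC_of_real)
    show "norm (g y) \<le> norm y * (1 / (cmod c - norm A))" for y
      using lower[of "g y"] c unfolding Kg by (simp add: field_simps)
  qed
  have gK: "g (blinfun_apply ?K x) = x" for x by (rule inj) (simp only: Kg)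
  have "Blinfun g \<in> bounded_ops" "Blinfun g o\<^sub>L ?K = id_blinfun" "?K o\<^sub>L Blinfun g = id_blinfun"
    using gK Kg scale
    by (simp_all add: bounded_ops_def blinfun_eq_iff bounded_linear_Blinfun_apply[OF lin])
  then show ?thesis unfolding spectrum_op_iff invertible_op_def by blast
qed

text \<open>Boundedness is what lets the supremum over a union split into a maximum.\<close>

lemma bdd_above_spectrum: "A \<in> bounded_ops \<Longrightarrow> bdd_above (insert 0 (cmod ` spectrum_op A))"
  using norm_less_imp_notin_spectrum[of A]
  by (intro bdd_aboveI[of _ "norm A"]) (auto simp: not_less[symmetric])

text \<open>Since \<open>AB = BA = 0\<close>, we have \<open>(A - c)(B - c) = - c (A + B - c)\<close>.\<close>

lemma spectrum_op_add:
  assumes AB: "A \<in> bounded_ops" "B \<in> bounded_ops" "A o\<^sub>L B = 0" "B o\<^sub>L A = 0" and c: "c \<noteq> 0"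
  shows "c \<in> spectrum_op (A + B) \<longleftrightarrow> c \<in> spectrum_op A \<or> c \<in> spectrum_op B"
proof -
  let ?K = "A - scalar_op c" and ?L = "B - scalar_op c" and ?S = "A + B - scalar_op c"
  have zero: "blinfun_apply A (blinfun_apply B x) = 0" "blinfun_apply B (blinfun_apply A x) = 0" for x
    using AB(3,4) by (metis blinfun_apply_blinfun_compose zero_blinfun.rep_eq)+
  have KL: "?K o\<^sub>L ?L = scalar_op (- c) o\<^sub>L ?S" and LK: "?L o\<^sub>L ?K = scalar_op (- c) o\<^sub>L ?S"
    by (rule blinfun_eqI, simp add: blinfun.diff_left blinfun.diff_right blinfun.add_left zero
        bounded_opsD[OF AB(1)] bounded_opsD[OF AB(2)] scaleC_minus_left scaleC_diff_right
        scaleC_add_right)+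
  have inv: "invertible_op (scalar_op d :: 'a \<Rightarrow>\<^sub>L 'a)" if "d \<noteq> 0" for d
    unfolding invertible_op_def blinfun_eq_iff using that
    by (intro bexI[of _ "scalar_op (inverse d)"])
      (simp_all add: scalar_op_in_bounded_ops scaleC_scaleC scaleC_one)
  have bd: "?K \<in> bounded_ops" "?L \<in> bounded_ops" "?S \<in> bounded_ops"
    using AB by (simp_all add: bounded_ops_add bounded_ops_diff scalar_op_in_bounded_ops)
  have "invertible_op ?K \<and> invertible_op ?L \<longleftrightarrow> invertible_op (?K o\<^sub>L ?L)"
    using invertible_op_compose[of ?K ?L] invertible_op_composeD[of ?K ?L]
      invertible_op_composeD[of ?L ?K] KL LK bd by metis
  also have "\<dots> \<longleftrightarrow> invertible_op ?S"
  proof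
    have "?S = scalar_op (inverse (- c)) o\<^sub>L (scalar_op (- c) o\<^sub>L ?S)"
      using c by (intro blinfun_eqI) (simp add: scaleC_scaleC scaleC_one)
    then show "invertible_op ?S" if "invertible_op (?K o\<^sub>L ?L)"
      using that invertible_op_compose[OF inv[of "inverse (- c)"]] c KL
      by (metis inverse_nonzero_iff_nonzero neg_equal_0_iff_equal)
    show "invertible_op (?K o\<^sub>L ?L)" if "invertible_op ?S"
      unfolding KL using that c by (intro invertible_op_compose inv) simp
  qed
  finally show ?thesis by (auto simp: spectrum_op_iff)
qed

text \<open>The spectra can differ at 0, as for complementary projections with invertible sum. The 0
  inserted in the definition of the radius absorbs this, so the sets of moduli agree
  exactly.\<close>

lemma spectral_radius_op_add:
  assumes "A \<in> bounded_ops" "B \<in> bounded_ops" "A o\<^sub>L B = 0" "B o\<^sub>L A = 0"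
  shows "spectral_radius_op (A + B) = max (spectral_radius_op A) (spectral_radius_op B)"
proof -
  have "insert 0 (cmod ` spectrum_op (A + B))
      = insert 0 (cmod ` spectrum_op A) \<union> insert 0 (cmod ` spectrum_op B)"
  proof (rule set_eqI)
    fix t
    have *: "t \<in> insert 0 (cmod ` X) \<longleftrightarrow> t = 0 \<or> (\<exists>c. c \<noteq> 0 \<and> c \<in> X \<and> t = cmod c)" for X
      by auto
    show "t \<in> insert 0 (cmod ` spectrum_op (A + B)) \<longleftrightarrow>
        t \<in> insert 0 (cmod ` spectrum_op A) \<union> insert 0 (cmod ` spectrum_op B)"
      unfolding Un_iff * using spectrum_op_add[OF assms] by blast
  qed
  then show ?thesis
    unfolding spectral_radius_op_def
    using cSup_union_distrib[OF _ bdd_above_spectrum[OF assms(1)] _ bdd_above_spectrum[OF assms(2)]]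
    by (simp add: sup_max)
qed

subsection \<open>Polar decomposition and splittings\<close>

text \<open>The null space of a selfadjoint operator is the orthogonal complement of its range. For
  proper splittings this reduces the two conditions to the one on ranges.\<close>

lemma op_null_eq_of_range_eq:
  assumes "selfadjoint_op A" "selfadjoint_op B" "op_range A = op_range B"
  shows "op_null A = op_null B"
proof -
  have "op_null C = {x. \<forall>y\<in>op_range C. x \<bullet> y = 0}" if "selfadjoint_op C" for C :: "'a \<Rightarrow>\<^sub>L 'a"
    unfolding op_null_def op_range_def
    by (auto simp: selfadjoint_op_inner[OF that, symmetric])
  then show ?thesis using assms by simp
qed

lemma op_range_diff_orthogonal:
  assumes A: "selfadjoint_op A" "closed (op_range A)"
    and B: "selfadjoint_op B" "closed (op_range B)"
    and AB: "A o\<^sub>L B = 0"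
  shows "op_range (A - B) = {x - y | x y. x \<in> op_range A \<and> y \<in> op_range B}"
proof (intro equalityI subsetI)
  fix w assume "w \<in> {x - y | x y. x \<in> op_range A \<and> y \<in> op_range B}"
  then obtain u v where w: "w = blinfun_apply A u - blinfun_apply B v"
    by (auto simp: op_range_def)
  let ?P = "range_proj A" and ?Q = "range_proj B"
  note P = range_proj_closed_range[OF selfadjoint_op_in_bounded_ops[OF A(1)] A(2)]
  note Q = range_proj_closed_range[OF selfadjoint_op_in_bounded_ops[OF B(1)] B(2)]
  have "A o\<^sub>L ?Q = 0"
    by (rule compose_eq_zero_cong[OF AB A(1) A(1) B(1) Q(1) refl Q(3)])
  moreover have "B o\<^sub>L A = 0"
    using selfadjoint_op_compose_commute[OF A(1) B(1)] AB selfadjoint_op_zero by simp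
  then have "B o\<^sub>L ?P = 0"
    by (rule compose_eq_zero_cong[OF _ B(1) B(1) A(1) P(1) refl P(3)])
  \<comment> \<open>One preimage serves both terms: \<open>A\<close> kills the \<open>?Q\<close>
    part and \<open>B\<close> kills the \<open>?P\<close> part.\<close>
  ultimately have "w = blinfun_apply (A - B) (blinfun_apply ?P u + blinfun_apply ?Q v)"
    using compose_range_proj[OF A] compose_range_proj[OF B]
    by (simp add: w blinfun_eq_iff blinfun.diff_left blinfun.add_right)
  then show "w \<in> op_range (A - B)" by simp
qed (auto simp: op_range_def blinfun.diff_left)

text \<open>If \<open>x\<close> in the closure of the range of \<open>T1\<close> equals \<open>T1 y - T2 y\<close>, then \<open>T2 y\<close> is orthogonal
  to itself, so \<open>x = T1 y\<close>.\<close>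

lemma pos_orth_decomp_closed_range:
  assumes "pos_orth_decomp T T1 T2" "closed (op_range T)"
  shows "closed (op_range T1)" "closed (op_range T2)" "T1 o\<^sub>L T2 = 0"
proof -
  let ?C1 = "closure (op_range T1)" and ?C2 = "closure (op_range T2)"
  have T: "T = T1 - T2" and sa: "selfadjoint_op T1" "selfadjoint_op T2"
    and sum: "{x + y | x y. x \<in> ?C1 \<and> y \<in> ?C2} = op_range T"
    and orth: "\<And>x y. x \<in> ?C1 \<Longrightarrow> y \<in> ?C2 \<Longrightarrow> x \<bullet> y = 0"
    using assms by (auto simp: pos_orth_decomp_def positive_op_def inner_eq_Re_cinner)
  have in_closure: "blinfun_apply T1 x \<in> ?C1" "blinfun_apply T2 x \<in> ?C2" for x
    using closure_subset by fastforce+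
  have zero: "0 \<in> ?C1" "0 \<in> ?C2" using in_closure[of 0] by simp_all
  have "x \<in> op_range T1" if x: "x \<in> ?C1" for x
  proof -
    have "x + 0 \<in> op_range T" using sum x zero by blast
    then obtain y where y: "x = blinfun_apply T1 y - blinfun_apply T2 y"
      by (auto simp: op_range_def T blinfun.diff_left)
    have "blinfun_apply T2 y \<bullet> blinfun_apply T2 y
        = blinfun_apply T1 y \<bullet> blinfun_apply T2 y - x \<bullet> blinfun_apply T2 y"
      by (simp add: y inner_diff_left)
    also have "\<dots> = 0" using orth x in_closure by simp
    finally show ?thesis using y by simp
  qed
  then show "closed (op_range T1)" using closure_subset by (metis closure_eq subsetI subset_antisym)
  have "y \<in> op_range T2" if y: "y \<in> ?C2" for y
  proof -
    have "0 + y \<in> op_range T" using sum y zero by blast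
    then obtain x where x: "y = blinfun_apply T1 x - blinfun_apply T2 x"
      by (auto simp: op_range_def T blinfun.diff_left)
    have "blinfun_apply T1 x \<bullet> blinfun_apply T1 x
        = blinfun_apply T1 x \<bullet> y + blinfun_apply T1 x \<bullet> blinfun_apply T2 x"
      by (simp add: x inner_diff_right)
    also have "\<dots> = 0" using orth y in_closure by simp
    finally have "y = blinfun_apply T2 (- x)" using x by (simp add: blinfun.minus_right)
    then show ?thesis by simp
  qed
  then show "closed (op_range T2)" using closure_subset by (metis closure_eq subsetI subset_antisym)
  show "T1 o\<^sub>L T2 = 0"
  proof (rule blinfun_eqI)
    fix x
    let ?y = "blinfun_apply T1 (blinfun_apply T2 x)"
    have "?y \<bullet> ?y = blinfun_apply T2 x \<bullet> blinfun_apply T1 ?y"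
      by (rule selfadjoint_op_inner[OF sa(1)])
    also have "\<dots> = 0" using orth in_closure by (metis inner_commute)
    finally show "blinfun_apply (T1 o\<^sub>L T2) x = blinfun_apply 0 x" by simp
  qed
qed

text \<open>The hypotheses make \<open>U o\<^sub>L U\<close> the orthogonal projection onto the
  range of \<open>T\<close>. A competitor vanishes on the complement, which is the null space of
  \<open>T\<close>, and on the range it is determined by its action after
  \<open>|T|\<close>.\<close>

lemma polar_isometry_eqI:
  assumes T: "selfadjoint_op T" and U: "selfadjoint_op U"
    and UUU: "U o\<^sub>L U o\<^sub>L U = U" and UB: "U o\<^sub>L abs_op T = T" and BU: "abs_op T o\<^sub>L U = T"
    and range: "op_range U = op_range T"
  shows "polar_isometry T = U"
  unfolding polar_isometry_def
proof (rule the_equality)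
  have UUU': "blinfun_apply U (blinfun_apply U (blinfun_apply U x)) = blinfun_apply U x" for x
    using UUU by (metis blinfun_apply_blinfun_compose)
  have null: "op_null U = op_null T" by (rule op_null_eq_of_range_eq[OF U T range])
  have in_null: "x - blinfun_apply U (blinfun_apply U x) \<in> op_null U" for x
    by (simp add: op_null_def blinfun.diff_right UUU')
  have "norm (blinfun_apply U x) = norm x" if x: "\<forall>y\<in>op_null U. cinner x y = 0" for x
  proof -
    have "x \<bullet> (x - blinfun_apply U (blinfun_apply U x)) = 0"
      using x in_null by (simp add: inner_eq_Re_cinner)
    then have "blinfun_apply U x \<bullet> blinfun_apply U x = x \<bullet> x"
      by (simp add: selfadjoint_op_inner[OF U] inner_diff_right)
    then show ?thesis by (simp add: norm_eq_sqrt_inner)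
  qed
  then show "partial_isometry_op U \<and> T = U o\<^sub>L abs_op T \<and> op_null U = op_null T"
    using selfadjoint_op_in_bounded_ops[OF U] UB null by (simp add: partial_isometry_op_def)
  fix U' assume U': "partial_isometry_op U' \<and> T = U' o\<^sub>L abs_op T \<and> op_null U' = op_null T"
  show "U' = U"
  proof (rule blinfun_eqI)
    fix x
    have "blinfun_apply U (blinfun_apply U x) \<in> op_range T"
      using blinfun_apply_in_op_range[of U "blinfun_apply U x"] by (simp only: range)
    then obtain z where z: "blinfun_apply U (blinfun_apply U x) = blinfun_apply T z"
      by (auto simp: op_range_def)
    \<comment> \<open>This exhibits the vector \<open>T z\<close> as a value of \<open>|T|\<close>,
      where \<open>U\<close> and \<open>U'\<close> both reproduce \<open>T\<close>.\<close>
    have Bz: "blinfun_apply (abs_op T) (blinfun_apply U z) = blinfun_apply T z"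
      using BU by (metis blinfun_apply_blinfun_compose)
    have "blinfun_apply U' x = blinfun_apply U' (blinfun_apply U (blinfun_apply U x))"
    proof -
      have "x - blinfun_apply U (blinfun_apply U x) \<in> op_null U'"
        using in_null[of x] U' null by (simp only:)
      then show ?thesis by (simp add: op_null_def blinfun.diff_right)
    qed
    also have "\<dots> = blinfun_apply T (blinfun_apply U z)"
      using U' Bz z by (metis blinfun_apply_blinfun_compose)
    also have "\<dots> = blinfun_apply U (blinfun_apply U (blinfun_apply U x))"
      using UB Bz z by (metis blinfun_apply_blinfun_compose)
    finally show "blinfun_apply U' x = blinfun_apply U x" by (simp add: UUU')
  qed
qed

theorem corollary4p13:
  fixes T T1 T2 V W Z :: "'a::chilbert_space \<Rightarrow>\<^sub>L 'a"
  assumes "selfadjoint_op T"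
    and "closed (op_range T)"
    and "pos_orth_decomp T T1 T2"
    and "V = polar_isometry T - T"
    and "W = T1 - range_proj T2 - T"
    and "Z = range_proj T1 - T2 - T"
  shows "proper_splitting T (polar_isometry T) V \<and>
    proper_splitting T (T1 - range_proj T2) W \<and>
    proper_splitting T (range_proj T1 - T2) Z \<and>
    (convergent_splitting T (polar_isometry T) V \<longleftrightarrow>
      convergent_splitting T (T1 - range_proj T2) W \<and>
      convergent_splitting T (range_proj T1 - T2) Z) \<and>
    (convergent_splitting T (polar_isometry T) V \<longrightarrow>
      max (spectral_radius_op (pinv_op (T1 - range_proj T2) o\<^sub>L W))
          (spectral_radius_op (pinv_op (range_proj T1 - T2) o\<^sub>L Z)) =
        spectral_radius_op (adjoint_op (polar_isometry T) o\<^sub>L V))"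
proof -
  define P1 P2 where P_def: "P1 = range_proj T1" "P2 = range_proj T2"
  have T: "T = T1 - T2" and pos: "positive_op T1" "positive_op T2"
    using assms(3) by (auto simp: pos_orth_decomp_def)
  note sa = positive_opD(1)[OF pos(1)] positive_opD(1)[OF pos(2)]
  note decomp = pos_orth_decomp_closed_range[OF assms(3,2)]
  note P1 = range_proj_closed_range[OF selfadjoint_op_in_bounded_ops[OF sa(1)] decomp(1), folded P_def]
  note P2 = range_proj_closed_range[OF selfadjoint_op_in_bounded_ops[OF sa(2)] decomp(2), folded P_def]
  have zero: "A o\<^sub>L B = 0" "B o\<^sub>L A = 0"
    if "selfadjoint_op A" "op_range A = op_range T1" "selfadjoint_op B" "op_range B = op_range T2"
    for A B
  proof -
    show "A o\<^sub>L B = 0"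
      by (rule compose_eq_zero_cong[OF decomp(3) sa(1) that(1) sa(2) that(3,2,4)])
    then show "B o\<^sub>L A = 0"
      using selfadjoint_op_compose_commute[OF that(1,3)] selfadjoint_op_zero by simp
  qed
  have ap: "blinfun_apply A (blinfun_apply B x) = blinfun_apply C x" if "A o\<^sub>L B = C"
    for A B C :: "'a \<Rightarrow>\<^sub>L 'a" and x
    using that by auto
  \<comment> \<open>A multiplication table for \<open>T1\<close>, \<open>T2\<close>,
    \<open>P1\<close>, \<open>P2\<close>: with it the remaining operator identities become
    simplifications.\<close>
  note mult = zero[OF sa(1) refl sa(2) refl, THEN ap] zero[OF sa(1) refl P2(1,3), THEN ap]
    zero[OF P1(1,3) sa(2) refl, THEN ap] zero[OF P1(1,3) P2(1,3), THEN ap]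
    P1(2)[THEN ap] P2(2)[THEN ap]
    range_proj_compose[OF sa(1) decomp(1), folded P_def, THEN ap]
    compose_range_proj[OF sa(1) decomp(1), folded P_def, THEN ap]
    range_proj_compose[OF sa(2) decomp(2), folded P_def, THEN ap]
    compose_range_proj[OF sa(2) decomp(2), folded P_def, THEN ap]
  note expand = blinfun_eq_iff blinfun.diff_left blinfun.diff_right blinfun.add_left
    blinfun.add_right blinfun.minus_left blinfun.minus_right mult

  \<comment> \<open>All three splittings, and \<open>T\<close> itself, have the form
    \<open>A - B\<close> with these ranges, so one argument covers them.\<close>
  have split: "selfadjoint_op (A - B)" "op_range (A - B) = op_range T"
      "proper_splitting T (A - B) (A - B - T)"
    if A: "selfadjoint_op A" "op_range A = op_range T1"
      and B: "selfadjoint_op B" "op_range B = op_range T2" for A B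
  proof -
    show sad: "selfadjoint_op (A - B)" by (rule selfadjoint_op_diff[OF A(1) B(1)])
    show range: "op_range (A - B) = op_range T"
      unfolding T op_range_diff_orthogonal[OF sa(1) decomp(1) sa(2) decomp(2,3)]
      using op_range_diff_orthogonal[OF A(1) _ B(1) _ zero(1)[OF A B]] A B decomp by simp
    show "proper_splitting T (A - B) (A - B - T)"
      unfolding proper_splitting_def
      using sad range op_null_eq_of_range_eq[OF sad assms(1) range]
      by (simp add: selfadjoint_op_in_bounded_ops bounded_ops_diff assms(1))
  qed
  note U = split[OF P1(1,3) P2(1,3)] and UW = split[OF sa(1) refl P2(1,3)]
    and UZ = split[OF P1(1,3) sa(2) refl]

  have "abs_op T = T1 + T2"
  proof (rule abs_op_eqI[OF assms(1)])
    show "positive_op (T1 + T2)"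
      using pos positive_opD(2)[OF pos(1)] positive_opD(2)[OF pos(2)]
      by (simp add: positive_op_def selfadjoint_op_add blinfun.add_left cinner_add_left
          inner_eq_Re_cinner)
    show "(T1 + T2) o\<^sub>L (T1 + T2) = T o\<^sub>L T" by (simp add: T expand)
  qed
  then have polar: "polar_isometry T = P1 - P2"
    by (intro polar_isometry_eqI assms(1) U) (simp_all add: T expand)
  have adj: "adjoint_op (P1 - P2) = P1 - P2" by (rule adjoint_op_selfadjoint[OF U(1)])
  \<comment> \<open>The square is a selfadjoint projection that fixes \<open>P1 - P2\<close>, so
    \<open>P1 - P2\<close> is its own pseudoinverse; being selfadjoint, it is also its own
    adjoint.\<close>
  have "(P1 - P2) o\<^sub>L (P1 - P2) = P1 + P2" by (simp add: expand)
  then have pinv: "pinv_op (P1 - P2) = P1 - P2"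
    using U(1) selfadjoint_op_add[OF P1(1) P2(1)]
    by (intro pinv_op_eqI) (simp_all add: selfadjoint_op_in_bounded_ops, simp_all add: expand)

  have V: "(P1 - P2) o\<^sub>L V = (P2 - T2) + (P1 - T1)"
    unfolding assms(4) polar by (simp add: T expand)
  have fix_range: "pinv_op A o\<^sub>L (A o\<^sub>L (A o\<^sub>L B)) = A o\<^sub>L B"
    if "selfadjoint_op A" "op_range A = op_range T" for A B
    using pinv_op_compose_self[OF that(1)] that(2) assms(2) by (metis blinfun_compose_assoc)
  \<comment> \<open>Applying \<open>T1 - P2\<close> flips the sign of \<open>W\<close>, so twice
    gives \<open>W\<close> back; \<open>fix_range\<close> then cancels one factor against the
    pseudoinverse.\<close>
  have "W = (T1 - P2) o\<^sub>L ((T1 - P2) o\<^sub>L W)" "(T1 - P2) o\<^sub>L W = P2 - T2"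
    by (simp_all add: assms(5) T P_def(2)[symmetric] expand)
  then have W: "pinv_op (T1 - P2) o\<^sub>L W = P2 - T2"
    using fix_range[OF UW(1,2), of W] by simp
  have "Z = (P1 - T2) o\<^sub>L ((P1 - T2) o\<^sub>L Z)" "(P1 - T2) o\<^sub>L Z = P1 - T1"
    by (simp_all add: assms(6) T P_def(1)[symmetric] expand)
  then have Z: "pinv_op (P1 - T2) o\<^sub>L Z = P1 - T1"
    using fix_range[OF UZ(1,2), of Z] by simp
  have radius: "spectral_radius_op ((P1 - P2) o\<^sub>L V)
      = max (spectral_radius_op (P2 - T2)) (spectral_radius_op (P1 - T1))"
    unfolding V
    by (intro spectral_radius_op_add bounded_ops_diff selfadjoint_op_in_bounded_ops sa P1(1) P2(1))
      (simp_all add: expand)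
  show ?thesis
    unfolding convergent_splitting_def polar P_def[symmetric] adj pinv W Z radius
    using U(3) UW(3) UZ(3) assms(4-6) by (simp add: polar P_def)
qed

end
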